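(* Let $\mathbb A$ be an algebra on $\mathbb R^3$ with unit $e$, let $F$ be an $\mathbb A$-algebrizable vector field defined on an open set $\Omega\subset\mathbb R^3$, $N\subset\Omega(F,\mathbb A^* )$ a simply connected neighborhood, and $H$ an $\mathbb A$-antiderivative of $\frac eF$. If $N$ is small enough, then $$d_F(w,w')=\|H(w)-H(w')\|$$ is the metric (on $N$) arising from the Riemannian metric $g=\frac{1}{\|e\|^2}H^*\lambda$ on $\Omega(F,\mathbb A^* )$.
   Context: An algebra $\mathbb A$ on $\mathbb R^3$ is the linear space $\mathbb R^3$ endowed with a bilinear, associative, commutative product with unit $e$. $\mathbb A^*$ is the set of regular (invertible) elements; the inverse of $a$ is written $\frac ea$. A function or vector field $F:\Omega\to\mathbb R^3$, $\Omega\subset\mathbb R^3$ open, is $\mathbb A$-algebrizable if there is $F':\Omega\to\mathbb R^3$ (its $\mathbb A$-derivative) with $\lim_{\xi\to0}|F(w+\xi)-F(w)-F'(w)\xi|/|\xi|=0$ for all $w\in\Omega$, where $F'(w)\xi$ is the product in $\mathbb A$. An $\mathbb A$-antiderivative of $K$ is an $\mathbb A$-algebrizable function $H$ with $H'=K$. $\Omega(F,\mathbb A^* )=F^{-1}(\mathbb A^* )$, and $\frac eF$ is the function $w\mapsto F(w)^{-1}$ on it. $\|\cdot\|$ is the Euclidean norm on $\mathbb R^3$ and $\lambda$ ($\lambda_{ij}=\delta_{ij}$) is the natural Riemannian metric of $\mathbb R^3$. In the definition of $g$ on $\Omega(F,\mathbb A^* )$, $H$ is the (possibly multivalued) function given locally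 by $H(w)=\int_\gamma\frac eF\,d\xi:=\int_0^a\frac e{F(\gamma(t))}\dot\gamma(t)\,dt$ (product in $\mathbb A$), with $\gamma:[0,a]\to\Omega(F,\mathbb A^* )$ a differentiable curve from a base point $w_0$ to $w$; it is locally an $\mathbb A$-antiderivative of $\frac eF$, and local antiderivatives differ by constants, so the pullback $H^*\lambda$ does not depend on the choice.
   Formalization: As stated the claim fails when ||e|| ≠ 1 (componentwise product, e=(1,1,1), F=e, H(w)=w); the formal version keeps g=(1/||e||^2)H^*λ and proves d_F = ||e|| times the distance arising from g, which is the literal claim when ||e||=1. *)

theory Defs
  imports "HOL-Analysis.Analysis"
begin

definition algebra_on_R3 :: "(real^3 \<Rightarrow> real^3 \<Rightarrow> real^3) \<Rightarrow> real^3 \<Rightarrow> bool" where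
  "algebra_on_R3 mul e \<longleftrightarrow> bilinear mul \<and> comm_monoid mul e"

definition regular_elements :: "(real^3 \<Rightarrow> real^3 \<Rightarrow> real^3) \<Rightarrow> real^3 \<Rightarrow> (real^3) set" where
  "regular_elements mul e = {a. \<exists>b. mul a b = e}"

(* Meaningful for regular a only, where the inverse is unique. *)
definition alg_inverse ::
  "(real^3 \<Rightarrow> real^3 \<Rightarrow> real^3) \<Rightarrow> real^3 \<Rightarrow> real^3 \<Rightarrow> real^3" where
  "alg_inverse mul e a = (THE b. mul a b = e)"

definition has_alg_derivative_on ::
  "(real^3 \<Rightarrow> real^3 \<Rightarrow> real^3) \<Rightarrow> (real^3 \<Rightarrow> real^3) \<Rightarrow> (real^3 \<Rightarrow> real^3) \<Rightarrow> (real^3) set \<Rightarrow> bool" where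
  "has_alg_derivative_on mul F F' \<Omega> \<longleftrightarrow>
     (\<forall>w\<in>\<Omega>. ((\<lambda>\<xi>. norm (F (w + \<xi>) - F w - mul (F' w) \<xi>) / norm \<xi>) \<longlongrightarrow> 0) (at 0))"

definition algebrizable_on ::
  "(real^3 \<Rightarrow> real^3 \<Rightarrow> real^3) \<Rightarrow> (real^3 \<Rightarrow> real^3) \<Rightarrow> (real^3) set \<Rightarrow> bool" where
  "algebrizable_on mul F \<Omega> \<longleftrightarrow> (\<exists>F'. has_alg_derivative_on mul F F' \<Omega>)"

definition alg_antiderivative_on ::
  "(real^3 \<Rightarrow> real^3 \<Rightarrow> real^3) \<Rightarrow> (real^3 \<Rightarrow> real^3) \<Rightarrow> (real^3 \<Rightarrow> real^3) \<Rightarrow> (real^3) set \<Rightarrow> bool" where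
  "alg_antiderivative_on mul H K N \<longleftrightarrow> has_alg_derivative_on mul H K N"

(* The preimage of the regular elements under the restriction of F to its domain. *)
definition regular_domain ::
  "(real^3 \<Rightarrow> real^3 \<Rightarrow> real^3) \<Rightarrow> real^3 \<Rightarrow> (real^3 \<Rightarrow> real^3) \<Rightarrow> (real^3) set \<Rightarrow> (real^3) set" where
  "regular_domain mul e F \<Omega> = {w \<in> \<Omega>. F w \<in> regular_elements mul e}"

definition alg_reciprocal ::
  "(real^3 \<Rightarrow> real^3 \<Rightarrow> real^3) \<Rightarrow> real^3 \<Rightarrow> (real^3 \<Rightarrow> real^3) \<Rightarrow> real^3 \<Rightarrow> real^3" where
  "alg_reciprocal mul e F w = alg_inverse mul e (F w)"

text \<open>A metric tensor is a function of a base point and two tangent vectors.\<close>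

type_synonym tensor2 = "real^3 \<Rightarrow> real^3 \<Rightarrow> real^3 \<Rightarrow> real"

definition euclidean_tensor :: tensor2 where
  "euclidean_tensor w \<xi> \<eta> = \<xi> \<bullet> \<eta>"

definition pullback :: "(real^3 \<Rightarrow> real^3) \<Rightarrow> tensor2 \<Rightarrow> tensor2" where
  "pullback H T w \<xi> \<eta> = T (H w) (frechet_derivative H (at w) \<xi>) (frechet_derivative H (at w) \<eta>)"

(* The multivalued primitive of e/F enters through its local branches: near w, any
   antiderivative of e/F.  Two branches differ by a constant near w, so their pullbacks of
   the Euclidean tensor at w agree and the tensor below does not depend on the choice. *)
definition is_local_branch ::
  "(real^3 \<Rightarrow> real^3 \<Rightarrow> real^3) \<Rightarrow> real^3 \<Rightarrow> (real^3 \<Rightarrow> real^3) \<Rightarrow> (real^3) set \<Rightarrow> real^3 \<Rightarrow> (real^3 \<Rightarrow> real^3) \<Rightarrow> bool" where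
  "is_local_branch mul e F \<Omega> w H \<longleftrightarrow>
     (\<exists>U. open U \<and> w \<in> U \<and> U \<subseteq> regular_domain mul e F \<Omega> \<and>
          alg_antiderivative_on mul H (alg_reciprocal mul e F) U)"

definition induced_tensor ::
  "(real^3 \<Rightarrow> real^3 \<Rightarrow> real^3) \<Rightarrow> real^3 \<Rightarrow> (real^3 \<Rightarrow> real^3) \<Rightarrow> (real^3) set \<Rightarrow> tensor2" where
  "induced_tensor mul e F \<Omega> w \<xi> \<eta> =
     1 / (norm e)\<^sup>2 * pullback (SOME H. is_local_branch mul e F \<Omega> w H) euclidean_tensor w \<xi> \<eta>"

definition riemannian_length :: "tensor2 \<Rightarrow> (real \<Rightarrow> real^3) \<Rightarrow> ennreal" where
  "riemannian_length g \<gamma> =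
     (\<integral>\<^sup>+t\<in>{0..1}. ennreal (sqrt (g (\<gamma> t) (vector_derivative \<gamma> (at t)) (vector_derivative \<gamma> (at t)))) \<partial>lborel)"

(* Infimum over the piecewise C1 curves in S; it is infinite between points that no such
   curve joins. *)
definition riemannian_distance :: "tensor2 \<Rightarrow> (real^3) set \<Rightarrow> real^3 \<Rightarrow> real^3 \<Rightarrow> ennreal" where
  "riemannian_distance g S x y =
     (INF \<gamma> \<in> {\<gamma>. valid_path \<gamma> \<and> path_image \<gamma> \<subseteq> S \<and> pathstart \<gamma> = x \<and> pathfinish \<gamma> = y}.
        riemannian_length g \<gamma>)"

end

theory Submission
  imports Defs
begin

text \<open>
  With respect to \<open>g\<close> the map \<open>H\<close> multiplies lengths by \<open>norm e\<close>, by the very definition of the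
  pullback, and near \<open>p\<close> it is a diffeomorphism onto an open set, because its derivative at \<open>w\<close> is
  multiplication by the invertible element \<open>e/F(w)\<close> and depends continuously on \<open>w\<close>. So the claim
  says that Euclidean distances in the image agree with the infimum of lengths of image curves.

  One inequality needs a curve whose image is a straight segment. Choose a ball of radius \<open>\<rho>\<close>
  around \<open>H p\<close> inside the image of the diffeomorphism; balls are convex, so segments in it lift
  along the local inverse \<open>G\<close> to admissible curves of the right length (\<open>lifted_segment\<close>).

  The other inequality concerns all curves in the whole regular domain, including those that leave
  the neighbourhood on which \<open>H\<close> is defined. As long as a curve stays inside, the fundamental
  theorem of calculus bounds the increment of \<open>H\<close> by the length (\<open>norm_increment_le_length\<close>). To
  leave, the image must first travel from the ball of radius \<open>\<rho>/3\<close> towards the boundary of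
  the ball of radius \<open>\<rho>\<close>, which costs \<open>2\<rho>/3\<close>; two points of the smaller ball are at distance less
  than that. So a curve that leaves is too long to violate the bound (\<open>short_curve_confined\<close>).

  The neighbourhood is therefore the preimage of the ball of radius \<open>\<rho>/3\<close>. It is constructed from
  one antiderivative; any other one on a connected open subset differs by a constant, which
  disappears from \<open>H w - H w'\<close>.
\<close>

section \<open>A length bound from the fundamental theorem of calculus\<close>

text \<open>
  The derivative is Henstock-Kurzweil integrable by the fundamental theorem of calculus, hence
  Lebesgue measurable. If its norm has infinite integral the bound is trivial, and otherwise the
  derivative is Lebesgue integrable with the same integral.
\<close>
lemma norm_increment_le_nn_integral:
  fixes f :: "real \<Rightarrow> 'a::euclidean_space"
  assumes "a \<le> b" "finite S" "continuous_on {a..b} f"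
    and der: "\<And>t. t \<in> {a<..<b} - S \<Longrightarrow> (f has_vector_derivative f' t) (at t)"
  shows "ennreal (norm (f b - f a)) \<le> (\<integral>\<^sup>+t\<in>{a..b}. ennreal (norm (f' t)) \<partial>lborel)"
proof -
  have FTC: "(f' has_integral (f b - f a)) {a..b}"
    using fundamental_theorem_of_calculus_interior_strong[OF assms(2,1) der assms(3)] .
  have meas: "f' \<in> borel_measurable (lebesgue_on {a..b})"
    using FTC integrable_imp_measurable by blast
  have eq: "(\<integral>\<^sup>+t. ennreal (norm (f' t)) \<partial>lebesgue_on {a..b})
      = (\<integral>\<^sup>+t\<in>{a..b}. ennreal (norm (f' t)) \<partial>lborel)"
    by (subst nn_integral_restrict_space) (auto simp: nn_integral_completion)
  show ?thesis
  proof (cases "(\<integral>\<^sup>+t. ennreal (norm (f' t)) \<partial>lebesgue_on {a..b}) < \<infinity>")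
    case True
    then have int: "integrable (lebesgue_on {a..b}) f'"
      using meas integrableI_bounded by blast
    then have "(f' has_integral (integral\<^sup>L (lebesgue_on {a..b}) f')) {a..b}"
      by (rule has_integral_integral_lebesgue_on) simp
    then have "integral\<^sup>L (lebesgue_on {a..b}) f' = f b - f a"
      using FTC has_integral_unique by blast
    then show ?thesis
      using integral_norm_bound_ennreal[OF int] eq by simp
  next
    case False
    then show ?thesis
      using eq by (simp add: not_less top_unique)
  qed
qed

section \<open>Calculus over the algebra\<close>

locale real3_algebra =
  fixes mul :: "real^3 \<Rightarrow> real^3 \<Rightarrow> real^3" and e :: "real^3"
  assumes algebra: "algebra_on_R3 mul e"
begin

sublocale prod: bounded_bilinear mul
  using algebra by (simp add: algebra_on_R3_def bilinear_conv_bounded_bilinear)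

sublocale mon: comm_monoid mul e
  using algebra by (simp add: algebra_on_R3_def)

lemma norm_unit_pos: "norm e > 0"
proof -
  have "mul e (axis 1 1) \<noteq> mul 0 (axis 1 1)"
    by (simp add: prod.zero_left axis_eq_0_iff)
  then have "e \<noteq> 0" by metis
  then show ?thesis by simp
qed

text \<open>
  The factor \<open>norm e\<close> is moved across inequalities of extended reals instead of into the infimum
  or the length integral, whose linearity would require measurability of the induced tensor along
  parts of a curve outside the domain of a given primitive.
\<close>
lemma scaled_le_iff:
  assumes "a \<ge> 0"
  shows "ennreal (a / norm e) \<le> d \<longleftrightarrow> ennreal a \<le> ennreal (norm e) * d"
proof -
  have "ennreal a = ennreal (norm e) * ennreal (a / norm e)"
    using assms norm_unit_pos by (simp flip: ennreal_mult)
  then show ?thesis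
    using norm_unit_pos by (simp add: ennreal_mult_le_mult_iff)
qed

lemma mul_alg_inverse:
  assumes "a \<in> regular_elements mul e"
  shows "mul a (alg_inverse mul e a) = e"
proof -
  obtain b where b: "mul a b = e"
    using assms by (auto simp: regular_elements_def)
  have unique: "c = b" if "mul a c = e" for c
  proof -
    have "mul c (mul a b) = mul (mul a c) b"
      by (simp add: mon.assoc mon.left_commute)
    then show ?thesis by (simp add: b that)
  qed
  show ?thesis
    unfolding alg_inverse_def by (rule theI[where P = "\<lambda>b. mul a b = e", OF b unique])
qed

lemma alg_inverse_cancel:
  assumes "a \<in> regular_elements mul e"
  shows "mul a (mul (alg_inverse mul e a) \<xi>) = \<xi>" "mul (alg_inverse mul e a) (mul a \<xi>) = \<xi>"
proof -
  show "mul a (mul (alg_inverse mul e a) \<xi>) = \<xi>"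
    using mul_alg_inverse[OF assms] by (simp flip: mon.assoc)
  then show "mul (alg_inverse mul e a) (mul a \<xi>) = \<xi>"
    by (simp only: mon.left_commute)
qed

lemma has_alg_derivative_on_iff:
  "has_alg_derivative_on mul F F' S \<longleftrightarrow> (\<forall>w\<in>S. (F has_derivative mul (F' w)) (at w))"
  unfolding has_alg_derivative_on_def has_derivative_at
  by (simp add: prod.bounded_linear_right)

lemma algebrizable_on_imp_continuous_on: "algebrizable_on mul F S \<Longrightarrow> continuous_on S F"
  unfolding algebrizable_on_def has_alg_derivative_on_iff
  by (meson continuous_at_imp_continuous_on has_derivative_continuous)

text \<open>
  The resolvent identity \<open>x\<inverse> - a\<inverse> = x\<inverse> a\<inverse> (a - x)\<close> gives the estimate. It involves the norm
  of \<open>x\<inverse>\<close> itself, which the same identity bounds by \<open>2 norm a\<inverse>\<close> for \<open>x\<close> near \<open>a\<close>.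
\<close>
lemma continuous_on_alg_inverse:
  "continuous_on (regular_elements mul e) (alg_inverse mul e)"
proof (clarsimp simp: continuous_on_def)
  fix a assume a: "a \<in> regular_elements mul e"
  let ?inv = "alg_inverse mul e" and ?R = "regular_elements mul e"
  obtain C where C: "C > 0" "\<And>x y. norm (mul x y) \<le> norm x * norm y * C"
    using prod.pos_bounded by blast
  define B where "B = norm (?inv a)"
  have diff: "?inv x - ?inv a = mul (mul (?inv x) (?inv a)) (a - x)" if "x \<in> ?R" for x
  proof -
    have "mul (mul (?inv x) (?inv a)) a = ?inv x"
      using mul_alg_inverse[OF a] by (simp add: mon.assoc mon.commute[of "?inv a" a])
    moreover have "mul (mul (?inv x) (?inv a)) x = ?inv a"
      using mul_alg_inverse[OF that]
      by (simp add: mon.commute[of "?inv x" "?inv a"] mon.commute[of "?inv x" x] mon.assoc)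
    ultimately show ?thesis by (simp add: prod.diff_right)
  qed
  have est: "norm (?inv x - ?inv a) \<le> norm (?inv x) * (B * C * C * norm (x - a))" if "x \<in> ?R" for x
  proof -
    have "norm (?inv x - ?inv a) \<le> norm (mul (?inv x) (?inv a)) * norm (a - x) * C"
      by (metis C(2) diff that)
    also have "\<dots> \<le> (norm (?inv x) * B * C) * norm (a - x) * C"
      using C by (intro mult_right_mono) (auto simp: B_def)
    finally show ?thesis by (simp add: norm_minus_commute mult_ac)
  qed
  have lim: "((\<lambda>x. B * C * C * norm (x - a)) \<longlongrightarrow> 0) (at a within ?R)"
    by (rule tendsto_eq_intros refl | simp)+
  then have small: "\<forall>\<^sub>F x in at a within ?R. B * C * C * norm (x - a) < 1 / 2"
    by (rule order_tendstoD) simp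
  have "\<forall>\<^sub>F x in at a within ?R. norm (?inv x - ?inv a) \<le> 2 * B * (B * C * C * norm (x - a))"
  proof (rule eventually_mono[OF eventually_conj[OF small]])
    show "\<forall>\<^sub>F x in at a within ?R. x \<in> ?R"
      by (simp add: eventually_at_filter)
    fix x assume x: "B * C * C * norm (x - a) < 1 / 2 \<and> x \<in> ?R"
    have "norm (?inv x) \<le> B + norm (?inv x - ?inv a)"
      unfolding B_def by (rule norm_triangle_sub)
    also have "norm (?inv x - ?inv a) \<le> norm (?inv x) * (B * C * C * norm (x - a))"
      using est x by blast
    also have "\<dots> \<le> norm (?inv x) * (1 / 2)"
      using x by (intro mult_left_mono) auto
    finally have "norm (?inv x) \<le> 2 * B" by simp
    then have "norm (?inv x) * (B * C * C * norm (x - a)) \<le> 2 * B * (B * C * C * norm (x - a))"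
      using C(1) by (intro mult_right_mono) (auto simp: B_def)
    then show "norm (?inv x - ?inv a) \<le> 2 * B * (B * C * C * norm (x - a))"
      using est[of x] x by linarith
  qed
  moreover have "((\<lambda>x. 2 * B * (B * C * C * norm (x - a))) \<longlongrightarrow> 0) (at a within ?R)"
    using tendsto_mult_right_zero[OF lim] .
  ultimately have "((\<lambda>x. ?inv x - ?inv a) \<longlongrightarrow> 0) (at a within ?R)"
    by (rule Lim_null_comparison)
  then show "(?inv \<longlongrightarrow> ?inv a) (at a within ?R)"
    using LIM_zero_cancel by blast
qed

lemma antiderivatives_differ_by_constant:
  assumes "open S" "connected S"
    and "has_alg_derivative_on mul H K S" "has_alg_derivative_on mul H' K S"
    and "x \<in> S" "y \<in> S"
  shows "H x - H y = H' x - H' y"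
proof -
  have "((\<lambda>w. H w - H' w) has_derivative (\<lambda>_. 0)) (at w)" if "w \<in> S" for w
    using has_derivative_diff[of H "mul (K w)" "at w" H' "mul (K w)"] assms(3,4) that
    by (simp add: has_alg_derivative_on_iff)
  then have "H x - H' x = H y - H' y"
    using has_derivative_zero_unique_connected[OF assms(1,2), of "\<lambda>w. H w - H' w" x y] assms(5,6)
    by blast
  then show ?thesis by (simp add: algebra_simps)
qed

end

section \<open>A primitive of the reciprocal field and the induced lengths\<close>

locale reciprocal_primitive = real3_algebra +
  fixes F :: "real^3 \<Rightarrow> real^3" and \<Omega> N :: "(real^3) set" and H :: "real^3 \<Rightarrow> real^3"
  assumes F_algebrizable: "algebrizable_on mul F \<Omega>"
    and open_N: "open N"
    and N_regular: "N \<subseteq> regular_domain mul e F \<Omega>"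
    and antiderivative: "alg_antiderivative_on mul H (alg_reciprocal mul e F) N"
begin

abbreviation "K \<equiv> alg_reciprocal mul e F"

abbreviation "g \<equiv> induced_tensor mul e F \<Omega>"

lemma F_regular: "w \<in> N \<Longrightarrow> F w \<in> regular_elements mul e"
  using N_regular by (auto simp: regular_domain_def)

lemma F_continuous: "continuous_on N F"
  by (rule continuous_on_subset[OF algebrizable_on_imp_continuous_on[OF F_algebrizable]])
    (use N_regular in \<open>auto simp: regular_domain_def\<close>)

lemma K_continuous: "continuous_on N K"
  unfolding alg_reciprocal_def
  by (rule continuous_on_compose2[OF continuous_on_alg_inverse F_continuous])
    (auto simp: F_regular)

lemma F_K_cancel:
  assumes "w \<in> N"
  shows "mul (F w) (mul (K w) \<xi>) = \<xi>" "mul (K w) (mul (F w) \<xi>) = \<xi>"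
  using alg_inverse_cancel[OF F_regular[OF assms]] by (simp_all add: alg_reciprocal_def)

lemma H_has_derivative: "w \<in> N \<Longrightarrow> (H has_derivative mul (K w)) (at w)"
  using antiderivative by (simp add: alg_antiderivative_on_def has_alg_derivative_on_iff)

lemma H_continuous: "continuous_on N H"
  using H_has_derivative
  by (auto intro!: continuous_at_imp_continuous_on has_derivative_continuous)

text \<open>
  The tensor is built from an arbitrarily chosen local branch at \<open>w\<close>. All branches have the same
  derivative at \<open>w\<close>, and \<open>H\<close> witnesses that there is one, so on \<open>N\<close> the tensor is explicit.
\<close>
lemma sqrt_induced_tensor:
  assumes "w \<in> N"
  shows "sqrt (g w \<xi> \<xi>) = norm (mul (K w) \<xi>) / norm e"
proof -
  let ?H = "SOME H. is_local_branch mul e F \<Omega> w H"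
  have "is_local_branch mul e F \<Omega> w H"
    using assms open_N N_regular antiderivative by (auto simp: is_local_branch_def)
  then have "is_local_branch mul e F \<Omega> w ?H"
    by (rule someI[where P = "is_local_branch mul e F \<Omega> w"])
  then have "(?H has_derivative mul (K w)) (at w)"
    unfolding is_local_branch_def alg_antiderivative_on_def has_alg_derivative_on_iff by blast
  then have "frechet_derivative ?H (at w) = mul (K w)"
    by (metis frechet_derivative_at)
  then show ?thesis
    by (simp add: induced_tensor_def pullback_def euclidean_tensor_def real_sqrt_divide
        flip: norm_eq_sqrt_inner)
qed

text \<open>
  The bound concerns an initial part of the curve since it is applied to curves that may leave \<open>N\<close>,
  up to their first exit. The rest of the curve contributes a nonnegative amount to the length.
\<close>
lemma norm_increment_le_length:
  assumes "valid_path \<gamma>" "0 \<le> s" "s \<le> 1" "\<gamma> ` {0..s} \<subseteq> N"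
  shows "ennreal (norm (H (\<gamma> s) - H (\<gamma> 0))) \<le> ennreal (norm e) * riemannian_length g \<gamma>"
proof -
  define v where "v t = vector_derivative \<gamma> (at t)" for t
  obtain S where cont: "continuous_on {0..1} \<gamma>" and S: "finite S" "\<gamma> C1_differentiable_on {0..1} - S"
    using assms(1) by (auto simp: valid_path_def piecewise_C1_differentiable_on_def)
  have der: "((H \<circ> \<gamma>) has_vector_derivative mul (K (\<gamma> t)) (v t)) (at t)"
    if t: "t \<in> {0<..<s} - S" for t
  proof -
    have "\<gamma> t \<in> N"
      using t assms(4) by auto
    then have H: "(H has_derivative mul (K (\<gamma> t))) (at (\<gamma> t) within range \<gamma>)"
      by (rule has_derivative_at_withinI[OF H_has_derivative])
    have "(\<gamma> has_vector_derivative v t) (at t)"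
      using S(2) t assms(3) unfolding v_def C1_differentiable_on_eq
      by (simp add: vector_derivative_works)
    then show ?thesis
      using H by (rule vector_derivative_diff_chain_within)
  qed
  have "continuous_on {0..s} (H \<circ> \<gamma>)"
    using assms(3)
    by (intro continuous_on_compose continuous_on_subset[OF H_continuous assms(4)]
        continuous_on_subset[OF cont]) auto
  \<comment> \<open>Dividing by \<open>norm e\<close> before integrating makes the integrand the speed with respect to \<open>g\<close>.\<close>
  then have "continuous_on {0..s} (\<lambda>t. (1 / norm e) *\<^sub>R (H \<circ> \<gamma>) t)"
    by (rule continuous_on_scaleR[OF continuous_on_const])
  moreover have "((\<lambda>t. (1 / norm e) *\<^sub>R (H \<circ> \<gamma>) t) has_vector_derivative
      (1 / norm e) *\<^sub>R mul (K (\<gamma> t)) (v t)) (at t)" if "t \<in> {0<..<s} - S" for t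
    using has_vector_derivative_scaleR[OF DERIV_const[of "1 / norm e"] der[OF that]] by simp
  ultimately have "ennreal (norm ((1 / norm e) *\<^sub>R H (\<gamma> s) - (1 / norm e) *\<^sub>R H (\<gamma> 0)))
      \<le> (\<integral>\<^sup>+t\<in>{0..s}. ennreal (norm ((1 / norm e) *\<^sub>R mul (K (\<gamma> t)) (v t))) \<partial>lborel)"
    using norm_increment_le_nn_integral[OF assms(2) S(1), of "\<lambda>t. (1 / norm e) *\<^sub>R (H \<circ> \<gamma>) t"
        "\<lambda>t. (1 / norm e) *\<^sub>R mul (K (\<gamma> t)) (v t)"]
    unfolding o_apply by blast
  also have "\<dots> \<le> riemannian_length g \<gamma>"
    unfolding riemannian_length_def v_def[symmetric]
  proof (rule nn_integral_mono)
    fix t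
    show "ennreal (norm ((1 / norm e) *\<^sub>R mul (K (\<gamma> t)) (v t))) * indicator {0..s} t
        \<le> ennreal (sqrt (g (\<gamma> t) (v t) (v t))) * indicator {0..1} t"
    proof (cases "t \<in> {0..s}")
      case True
      then have "sqrt (g (\<gamma> t) (v t) (v t)) = norm ((1 / norm e) *\<^sub>R mul (K (\<gamma> t)) (v t))"
        using assms(4) by (subst sqrt_induced_tensor) auto
      then show ?thesis using True assms(3) by simp
    qed simp
  qed
  finally have "ennreal (norm ((1 / norm e) *\<^sub>R (H (\<gamma> s) - H (\<gamma> 0)))) \<le> riemannian_length g \<gamma>"
    by (simp only: scaleR_diff_right)
  then show ?thesis
    by (simp add: scaled_le_iff)
qed

text \<open>
  The inverse function theorem applies as \<open>w \<mapsto> e/F(w)\<close> is continuous; the derivative of the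
  inverse at \<open>H w\<close> inverts multiplication by \<open>e/F(w)\<close>, so it is multiplication by \<open>F(w)\<close>.
\<close>
lemma local_inverse:
  assumes "p \<in> N"
  obtains U V G where "open U" "U \<subseteq> N" "p \<in> U" "open V" "homeomorphism U V H G"
    "\<forall>y\<in>V. (G has_derivative mul (F (G y))) (at y)"
proof -
  have "continuous_on N (\<lambda>w. prod.prod_right (K w))"
    using bounded_linear.continuous_on[OF prod.bounded_linear_prod_right K_continuous] .
  moreover have "prod.prod_right (F p) o\<^sub>L prod.prod_right (K p) = id_blinfun"
    by (rule blinfun_eqI) (simp add: F_K_cancel assms)
  ultimately obtain U V G G' where *: "open U" "U \<subseteq> N" "p \<in> U" "open V" "homeomorphism U V H G"
      "\<And>y. y \<in> V \<Longrightarrow> (G has_derivative G' y) (at y)"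
      "\<And>y. y \<in> V \<Longrightarrow> G' y = inv (blinfun_apply (prod.prod_right (K (G y))))"
    using inverse_function_theorem[OF open_N, of H "\<lambda>w. prod.prod_right (K w)" p]
      H_has_derivative assms by (metis prod.prod_right.rep_eq)
  have "G' y = mul (F (G y))" if "y \<in> V" for y
  proof -
    have "G y \<in> N"
      using *(2,5) that by (auto simp: homeomorphism_def)
    then have "inv (mul (K (G y))) = mul (F (G y))"
      by (intro inv_unique_comp) (auto simp: F_K_cancel)
    then show ?thesis using *(7)[OF that] by simp
  qed
  then show thesis using that * by metis
qed

text \<open>
  The velocity of the lifted segment is \<open>F\<close> times the direction \<open>b - a\<close>. The tensor multiplies it
  by \<open>e/F\<close> again, so the speed is constant.
\<close>
lemma lifted_segment:
  assumes hom: "homeomorphism U V H G" and "U \<subseteq> N"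
    and der: "\<And>y. y \<in> V \<Longrightarrow> (G has_derivative mul (F (G y))) (at y)"
    and seg: "closed_segment a b \<subseteq> V"
  defines "\<gamma> \<equiv> G \<circ> linepath a b"
  shows "valid_path \<gamma>" "path_image \<gamma> \<subseteq> U"
    and "ennreal (norm e) * riemannian_length g \<gamma> = ennreal (norm (b - a))"
proof -
  have GV: "G y \<in> U" if "y \<in> V" for y
    using hom that by (auto simp: homeomorphism_def)
  have inV: "linepath a b t \<in> V" if "t \<in> {0..1}" for t
    using seg that by (auto simp: linepath_in_path)
  show im: "path_image \<gamma> \<subseteq> U"
    using inV GV by (auto simp: \<gamma>_def path_image_def)
  have vd: "(\<gamma> has_vector_derivative mul (F (\<gamma> t)) (b - a)) (at t)" if "t \<in> {0..1}" for t
    unfolding \<gamma>_def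
    using vector_derivative_diff_chain_within[OF has_vector_derivative_linepath_within
        has_derivative_at_withinI[OF der[OF inV[OF that]]]]
    by (simp add: o_def)
  have cont: "continuous_on {0..1} \<gamma>"
    by (meson vd continuous_at_imp_continuous_on has_vector_derivative_continuous)
  have "continuous_on {0..1} (\<lambda>t. F (\<gamma> t))"
    using im \<open>U \<subseteq> N\<close> by (intro continuous_on_compose2[OF F_continuous cont]) (auto simp: path_image_def)
  then have "continuous_on {0..1} (\<lambda>t. mul (F (\<gamma> t)) (b - a))"
    by (intro prod.continuous_on continuous_on_const)
  then have "\<gamma> C1_differentiable_on {0..1}"
    unfolding C1_differentiable_on_def
    by (intro exI[of _ "\<lambda>t. mul (F (\<gamma> t)) (b - a)"]) (simp add: vd)
  then show "valid_path \<gamma>"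
    unfolding valid_path_def by (rule C1_differentiable_imp_piecewise)
  have speed: "sqrt (g (\<gamma> t) (vector_derivative \<gamma> (at t)) (vector_derivative \<gamma> (at t)))
      = norm (b - a) / norm e" if "t \<in> {0..1}" for t
  proof -
    have "\<gamma> t \<in> N"
      using im \<open>U \<subseteq> N\<close> imageI[OF that, of \<gamma>] unfolding path_image_def by blast
    moreover have "vector_derivative \<gamma> (at t) = mul (F (\<gamma> t)) (b - a)"
      using vd[OF that] by (rule vector_derivative_at)
    ultimately show ?thesis
      by (simp add: sqrt_induced_tensor F_K_cancel)
  qed
  have "riemannian_length g \<gamma> = (\<integral>\<^sup>+t\<in>{0..1::real}. ennreal (norm (b - a) / norm e) \<partial>lborel)"
    unfolding riemannian_length_def
    by (intro nn_integral_cong) (simp add: speed split: split_indicator)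
  also have "\<dots> = ennreal (norm (b - a) / norm e)"
    by (simp add: nn_integral_cmult_indicator)
  finally show "ennreal (norm e) * riemannian_length g \<gamma> = ennreal (norm (b - a))"
    using norm_unit_pos by (simp flip: ennreal_mult)
qed

text \<open>
  Suppose the curve leaves the preimage \<open>W\<close> of the open ball. Up to the first exit time \<open>s\<close> its
  image under \<open>H\<close> has moved by at most \<open>l\<close>, so it stays in the closed ball of radius
  \<open>r + l < \<rho>\<close>. The preimage \<open>Q\<close> of that closed ball is compact, so it also contains
  the limit \<open>\<gamma> s\<close>, and it is part of \<open>W\<close>: a contradiction.
\<close>
lemma short_curve_confined:
  assumes hom: "homeomorphism U V H G" and "U \<subseteq> N" "open U" and ball: "ball c \<rho> \<subseteq> V"
    and \<gamma>: "valid_path \<gamma>" "\<gamma> 0 \<in> U" "H (\<gamma> 0) \<in> cball c r"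
    and short: "ennreal (norm e) * riemannian_length g \<gamma> \<le> ennreal l" "0 \<le> l" "r + l < \<rho>"
  shows "path_image \<gamma> \<subseteq> U"
proof (rule ccontr)
  define W where "W = U \<inter> H -` ball c \<rho>"
  define T where "T = {t \<in> {0..1}. \<gamma> t \<notin> W}"
  have cont: "continuous_on {0..1} \<gamma>"
    using \<gamma>(1) by (simp add: valid_path_def piecewise_C1_differentiable_on_def)
  have HU: "continuous_on U H" and GV: "continuous_on V G" and
    inv: "\<And>w. w \<in> U \<Longrightarrow> G (H w) = w \<and> H w \<in> V" "\<And>y. y \<in> V \<Longrightarrow> H (G y) = y \<and> G y \<in> U"
    using hom by (auto simp: homeomorphism_def)
  have "open W"
    unfolding W_def using HU \<open>open U\<close> by (rule continuous_open_preimage) simp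
  assume "\<not> path_image \<gamma> \<subseteq> U"
  then have "T \<noteq> {}"
    by (auto simp: T_def W_def path_image_def)
  have "closed ({0..1} \<inter> \<gamma> -` (- W))"
    using cont \<open>open W\<close> by (intro continuous_closed_preimage) auto
  moreover have "{0..1} \<inter> \<gamma> -` (- W) = T"
    by (auto simp: T_def)
  ultimately have "closed T" by simp
  define s where "s = Inf T"
  have bdd: "bdd_below T" by (rule bdd_belowI[of _ 0]) (auto simp: T_def)
  have "s \<in> T"
    unfolding s_def using closed_contains_Inf[OF \<open>T \<noteq> {}\<close> bdd \<open>closed T\<close>] .
  have before: "\<gamma> t \<in> W" if "t \<in> {0..<s}" for t
  proof (rule ccontr)
    assume "\<gamma> t \<notin> W"
    then have "t \<in> T" using that \<open>s \<in> T\<close> by (auto simp: T_def)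
    then show False using cInf_lower[OF _ bdd, of t] that by (simp add: s_def)
  qed
  have "\<gamma> 0 \<in> W"
    using \<gamma>(2,3) short(2,3) by (auto simp: W_def)
  then have "0 < s" "s \<le> 1"
    using \<open>s \<in> T\<close> by (auto simp: T_def less_le)
  define Q where "Q = G ` cball c (r + l)"
  have cV: "cball c (r + l) \<subseteq> ball c \<rho>"
    using short(3) by auto
  then have "compact Q"
    unfolding Q_def using ball
    by (intro compact_continuous_image continuous_on_subset[OF GV]) auto
  have "\<gamma> t \<in> Q" if t: "t \<in> {0..<s}" for t
  proof -
    have "\<gamma> ` {0..t} \<subseteq> N"
      using before t \<open>U \<subseteq> N\<close> by (auto simp: W_def)
    then have "ennreal (norm (H (\<gamma> t) - H (\<gamma> 0))) \<le> ennreal l"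
      using norm_increment_le_length[OF \<gamma>(1), of t] t \<open>s \<le> 1\<close> short(1) by fastforce
    then have "dist (H (\<gamma> t)) (H (\<gamma> 0)) \<le> l"
      using short(2) by (simp add: dist_norm)
    then have "H (\<gamma> t) \<in> cball c (r + l)"
      using \<gamma>(3) dist_triangle[of c "H (\<gamma> t)" "H (\<gamma> 0)"] by (simp add: dist_commute)
    moreover have "G (H (\<gamma> t)) = \<gamma> t"
      using before[OF t] inv by (simp add: W_def)
    ultimately show ?thesis unfolding Q_def by force
  qed
  then have "\<forall>\<^sub>F t in at s within {0..<s}. \<gamma> t \<in> Q"
    by (simp add: eventually_at_filter)
  moreover have "at s within {0..<s} \<noteq> bot"
  proof -
    have "s islimpt {0..<s}"
      using \<open>0 < s\<close> by (simp add: islimpt_Ico)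
    then show ?thesis by (simp add: trivial_limit_within)
  qed
  moreover have "(\<gamma> \<longlongrightarrow> \<gamma> s) (at s within {0..<s})"
  proof (rule tendsto_within_subset)
    show "(\<gamma> \<longlongrightarrow> \<gamma> s) (at s within {0..1})"
      using cont \<open>0 < s\<close> \<open>s \<le> 1\<close> by (simp add: continuous_on_def)
  qed (use \<open>s \<le> 1\<close> in auto)
  ultimately have sQ: "\<gamma> s \<in> Q"
    by (rule Lim_in_closed_set[OF compact_imp_closed[OF \<open>compact Q\<close>]])
  have "Q \<subseteq> W"
  proof
    fix w assume "w \<in> Q"
    then obtain y where y: "y \<in> cball c (r + l)" "w = G y"
      unfolding Q_def by blast
    then have "y \<in> ball c \<rho>" "y \<in> V"
      using cV ball by blast+
    then show "w \<in> W"
      using inv(2) y(2) by (simp add: W_def)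
  qed
  then have "\<gamma> s \<in> W"
    using sQ by blast
  then show False using \<open>s \<in> T\<close> by (simp add: T_def)
qed

lemma distance_eq_near:
  assumes "p \<in> N"
  obtains U where "open U" "p \<in> U" "U \<subseteq> N" "inj_on H U"
    "\<forall>w\<in>U. \<forall>w'\<in>U. ennreal (norm e) *
       riemannian_distance g (regular_domain mul e F \<Omega>) w w' = ennreal (norm (H w - H w'))"
proof -
  obtain U V G where UV: "open U" "U \<subseteq> N" "p \<in> U" "open V" and hom: "homeomorphism U V H G"
    and der: "\<forall>y\<in>V. (G has_derivative mul (F (G y))) (at y)"
    by (rule local_inverse[OF assms])
  have inv: "\<And>w. w \<in> U \<Longrightarrow> G (H w) = w \<and> H w \<in> V" and HU: "continuous_on U H"
    using hom by (auto simp: homeomorphism_def)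
  obtain \<rho> where \<rho>: "\<rho> > 0" "ball (H p) \<rho> \<subseteq> V"
    using \<open>open V\<close> inv \<open>p \<in> U\<close> open_contains_ball by blast
  define B where "B = ball (H p) (\<rho> / 3)"
  define U0 where "U0 = U \<inter> H -` B"
  have U0: "open U0"
    unfolding U0_def B_def using HU UV(1) by (rule continuous_open_preimage) simp
  have pU0: "p \<in> U0" "U0 \<subseteq> N"
    using UV \<rho> by (auto simp: U0_def B_def)
  have inj: "inj_on H U0"
    by (rule inj_onI) (metis IntE U0_def inv)
  have dist: "ennreal (norm e) * riemannian_distance g (regular_domain mul e F \<Omega>) w w'
      = ennreal (norm (H w - H w'))" if w: "w \<in> U0" "w' \<in> U0" for w w'
  proof (rule antisym)
    let ?P = "{\<gamma>. valid_path \<gamma> \<and> path_image \<gamma> \<subseteq> regular_domain mul e F \<Omega> \<and>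
      pathstart \<gamma> = w \<and> pathfinish \<gamma> = w'}"
    let ?D = "riemannian_distance g (regular_domain mul e F \<Omega>) w w'"
    have HB: "H w \<in> B" "H w' \<in> B" and wU: "w \<in> U" "w' \<in> U"
      using w by (auto simp: U0_def)
    have "B \<subseteq> V"
      using \<rho> subset_ball[of "\<rho>/3" \<rho> "H p"] by (auto simp: B_def)
    then have seg: "closed_segment (H w) (H w') \<subseteq> V"
      using HB closed_segment_subset[of "H w" B "H w'"] by (auto simp: B_def)
    let ?\<gamma> = "G \<circ> linepath (H w) (H w')"
    note lift = lifted_segment[OF hom UV(2) der[rule_format] seg]
    have "?\<gamma> \<in> ?P"
      using lift(1,2) UV(2) N_regular inv wU by (auto simp: pathstart_def pathfinish_def linepath_def)
    then have "?D \<le> riemannian_length g ?\<gamma>"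
      unfolding riemannian_distance_def by (rule INF_lower)
    then have "ennreal (norm e) * ?D \<le> ennreal (norm e) * riemannian_length g ?\<gamma>"
      by (rule mult_left_mono) simp
    then show "ennreal (norm e) * ?D \<le> ennreal (norm (H w - H w'))"
      using lift(3) by (simp add: norm_minus_commute)
    have "ennreal (norm (H w - H w') / norm e) \<le> ?D"
      unfolding riemannian_distance_def
    proof (rule INF_greatest)
      fix \<gamma> assume "\<gamma> \<in> ?P"
      then have \<gamma>: "valid_path \<gamma>" "\<gamma> 0 = w" "\<gamma> 1 = w'"
        by (auto simp: pathstart_def pathfinish_def)
      \<comment> \<open>A start within \<open>\<rho>/3\<close> of the centre and a length budget below \<open>2\<rho>/3\<close> keep the curve inside.\<close>
      define l where "l = norm (H w - H w')"
      have "l \<le> dist (H p) (H w) + dist (H p) (H w')"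
        unfolding l_def by norm
      also have "\<dots> < 2 * \<rho> / 3"
        using HB by (simp add: B_def)
      finally have l: "\<rho> / 3 + l < \<rho>" by simp
      have "ennreal l \<le> ennreal (norm e) * riemannian_length g \<gamma>"
      proof (rule ccontr)
        assume long: "\<not> ?thesis"
        then have "path_image \<gamma> \<subseteq> U"
          using short_curve_confined[OF hom UV(2,1) \<rho>(2) \<gamma>(1), of "\<rho> / 3" l] l \<gamma>(2) wU HB
          by (simp add: B_def l_def)
        then have "\<gamma> ` {0..1} \<subseteq> N"
          using UV(2) by (auto simp: path_image_def)
        then show False
          using norm_increment_le_length[OF \<gamma>(1), of 1] long \<gamma>
          by (simp add: l_def norm_minus_commute)
      qed
      then show "ennreal (norm (H w - H w') / norm e) \<le> riemannian_length g \<gamma>"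
        by (simp add: scaled_le_iff l_def)
    qed
    then show "ennreal (norm (H w - H w')) \<le> ennreal (norm e) * ?D"
      by (simp add: scaled_le_iff)
  qed
  show thesis
    by (rule that[OF U0 pU0 inj]) (intro ballI dist)
qed

end

section \<open>The distance formula\<close>

theorem theorem5p1:
  fixes mul :: "real^3 \<Rightarrow> real^3 \<Rightarrow> real^3" and e :: "real^3"
    and F :: "real^3 \<Rightarrow> real^3" and \<Omega> :: "(real^3) set" and p :: "real^3"
  assumes "algebra_on_R3 mul e"
    and "open \<Omega>"
    and "algebrizable_on mul F \<Omega>"
    and "p \<in> regular_domain mul e F \<Omega>"
  shows "\<exists>U. open U \<and> p \<in> U \<and>
    (\<forall>N H. open N \<and> p \<in> N \<and> simply_connected N \<and> N \<subseteq> regular_domain mul e F \<Omega> \<and>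
           alg_antiderivative_on mul H (alg_reciprocal mul e F) N \<and> N \<subseteq> U \<longrightarrow>
       Metric_space N (\<lambda>w w'. norm (H w - H w')) \<and>
       (\<forall>w\<in>N. \<forall>w'\<in>N.
          ennreal (norm (H w - H w')) =
            ennreal (norm e) *
            riemannian_distance (induced_tensor mul e F \<Omega>) (regular_domain mul e F \<Omega>) w w'))"
proof -
  interpret real3_algebra mul e
    by unfold_locales (rule assms(1))
  let ?R = "regular_domain mul e F \<Omega>" and ?K = "alg_reciprocal mul e F"
  \<comment> \<open>Naming the conclusion keeps it opaque to the quantifier reasoning about \<open>U\<close>.\<close>
  define good where "good N H \<longleftrightarrow>
      Metric_space N (\<lambda>w w'. norm (H w - H w')) \<and>
      (\<forall>w\<in>N. \<forall>w'\<in>N. ennreal (norm (H w - H w')) =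
        ennreal (norm e) * riemannian_distance (induced_tensor mul e F \<Omega>) ?R w w')"
    for N :: "(real^3) set" and H :: "real^3 \<Rightarrow> real^3"
  show ?thesis
    unfolding good_def[symmetric]
  proof (cases "\<exists>N H. open N \<and> p \<in> N \<and> N \<subseteq> ?R \<and> alg_antiderivative_on mul H ?K N")
    case False
    \<comment> \<open>Without any antiderivative near \<open>p\<close> the claim is vacuous; so existence of one may be assumed.\<close>
    then have "open UNIV \<and> p \<in> UNIV \<and> (\<forall>N H. open N \<and> p \<in> N \<and> simply_connected N \<and> N \<subseteq> ?R \<and>
        alg_antiderivative_on mul H ?K N \<and> N \<subseteq> UNIV \<longrightarrow> good N H)"
      by auto
    then show "\<exists>U. open U \<and> p \<in> U \<and> (\<forall>N H. open N \<and> p \<in> N \<and> simply_connected N \<and> N \<subseteq> ?R \<and>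
        alg_antiderivative_on mul H ?K N \<and> N \<subseteq> U \<longrightarrow> good N H)" ..
  next
    case True
    then obtain N0 H0 where N0: "open N0" "p \<in> N0" "N0 \<subseteq> ?R" "alg_antiderivative_on mul H0 ?K N0"
      by blast
    then interpret reciprocal_primitive mul e F \<Omega> N0 H0
      using assms(3) by unfold_locales
    obtain U where U: "open U" "p \<in> U" "U \<subseteq> N0" "inj_on H0 U"
      and dist: "\<forall>w\<in>U. \<forall>w'\<in>U. ennreal (norm e) *
        riemannian_distance (induced_tensor mul e F \<Omega>) ?R w w' = ennreal (norm (H0 w - H0 w'))"
      by (rule distance_eq_near[OF N0(2)])
    have "good N H" if N: "open N" "simply_connected N" "N \<subseteq> U" and H: "alg_antiderivative_on mul H ?K N" for N H
    proof -
      have "has_alg_derivative_on mul H0 ?K N"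
        using N0(4) N(3) U(3) by (auto simp: alg_antiderivative_on_def has_alg_derivative_on_def)
      then have eq: "H w - H w' = H0 w - H0 w'" if "w \<in> N" "w' \<in> N" for w w'
        using antiderivatives_differ_by_constant[OF N(1) simply_connected_imp_connected[OF N(2)]
            H[unfolded alg_antiderivative_on_def] _ that] by blast
      have "Metric_space N (\<lambda>w w'. norm (H w - H w'))"
      proof
        fix x y z :: "real^3"
        show "0 \<le> norm (H x - H y)" by simp
        show "norm (H x - H y) = norm (H y - H x)" by (rule norm_minus_commute)
        show "norm (H x - H z) \<le> norm (H x - H y) + norm (H y - H z)"
          using dist_triangle[of "H x" "H z" "H y"] by (simp add: dist_norm)
      next
        fix x y assume xy: "x \<in> N" "y \<in> N"
        have "norm (H x - H y) = 0 \<longleftrightarrow> H0 x = H0 y"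
          by (simp only: eq[OF xy]) simp
        also have "\<dots> \<longleftrightarrow> x = y"
          using xy N(3) inj_on_eq_iff[OF U(4)] by blast
        finally show "norm (H x - H y) = 0 \<longleftrightarrow> x = y" .
      qed
      moreover have "ennreal (norm (H w - H w')) =
          ennreal (norm e) * riemannian_distance (induced_tensor mul e F \<Omega>) ?R w w'"
        if "w \<in> N" "w' \<in> N" for w w'
      proof -
        have "w \<in> U" "w' \<in> U" using that N(3) by auto
        then show ?thesis using dist eq[OF that] by simp
      qed
      ultimately show ?thesis unfolding good_def by blast
    qed
    then show "\<exists>U. open U \<and> p \<in> U \<and> (\<forall>N H. open N \<and> p \<in> N \<and> simply_connected N \<and> N \<subseteq> ?R \<and>
        alg_antiderivative_on mul H ?K N \<and> N \<subseteq> U \<longrightarrow> good N H)"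
      using U(1,2) by blast
  qed
qed

end
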